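(* Let $p>3$ be a prime. Then $$6\sum_{k=0}^{[\frac{p-1}{12}]}\frac{\binom{12k}{6k}}{4^{6k}}\equiv\begin{cases}2\cdot3^{(p-1)/4}+3\pmod p&\text{if }p\equiv1\pmod{24},\\ 3^{(p-1)/4}-2\pmod p&\text{if }p\equiv5\pmod{24},\\ -2\pmod p&\text{if }p\equiv7\pmod{24},\\ -3^{(p+1)/4}\pmod p&\text{if }p\equiv11\pmod{24},\\ 1-2\cdot3^{(p-1)/4}\pmod p&\text{if }p\equiv13\pmod{24},\\ -3^{(p-1)/4}\pmod p&\text{if }p\equiv17\pmod{24},\\ -3\pmod p&\text{if }p\equiv19\pmod{24},\\ 2+3^{(p+1)/4}\pmod p&\text{if }p\equiv23\pmod{24}.\end{cases}$$
   Context: $[x]$ is the greatest integer not exceeding $x$.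
   Formalization: In the case p ≡ 7 (mod 24) the residue −2 is replaced by −1, since the printed value is false (for p = 7 the left side is 6 ≡ −1, not −2, mod 7); the other seven cases are as stated. *)

theory Defs
  imports Complex_Main "HOL-Computational_Algebra.Primes"
begin

text \<open>
  Congruence of rational numbers modulo a prime \<open>p\<close>, as usual in the ring of rationals
  whose reduced denominator is prime to \<open>p\<close>.
\<close>

definition p_integral :: "nat \<Rightarrow> rat \<Rightarrow> bool" where
  "p_integral p x \<longleftrightarrow> coprime (snd (quotient_of x)) (int p)"

definition rat_cong :: "nat \<Rightarrow> rat \<Rightarrow> rat \<Rightarrow> bool" where
  "rat_cong p a b \<longleftrightarrow>
     p_integral p a \<and> p_integral p b \<and> (\<exists>c. p_integral p c \<and> a - b = of_nat p * c)"

text \<open>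
  Erratum: for \<open>p mod 24 = 7\<close> the source prints the residue \<open>-2\<close>, which is false already
  for \<open>p = 7\<close>, where the left-hand side is \<open>6\<close>. Put \<open>m = (p - 1) / 2\<close>. Modulo \<open>p\<close> the
  left-hand side is the sum of \<open>(1 + z) ^ m\<close> over the sixth roots of unity \<open>z\<close>, i.e.
  \<open>2 ^ m + 2 * cos (pi * m / 3) + 2 * sqrt 3 ^ m * cos (pi * m / 6)\<close>. For
  \<open>p mod 24 = 7\<close> these terms are \<open>1\<close>, \<open>-2\<close> and \<open>0\<close>, so the residue is \<open>-1\<close>.
\<close>

end

theory Submission
  imports Defs "HOL-Number_Theory.Number_Theory"
begin

text \<open>
  Put \<open>m = (p - 1) / 2\<close>. Since \<open>m\<close> is congruent to \<open>- 1 / 2\<close> modulo \<open>p\<close>, the central binomial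
  coefficient \<open>2 * j choose j\<close> is congruent to \<open>(- 4) ^ j * (m choose j)\<close>, which turns the sum
  into the sum of the \<open>m choose (6 * k)\<close>. Filtering the binomial expansion with the sixth roots of
  unity evaluates the latter exactly; the only term that still depends on \<open>p\<close> beyond powers
  of 3 is \<open>2 ^ m\<close>, whose residue \<open>1\<close> or \<open>-1\<close> is given by Gauss' lemma.
\<close>

section \<open>Reducing rational congruences to integer ones\<close>

lemma p_integral_of_int_divide:
  assumes "coprime b (int p)" "b \<noteq> 0"
  shows "p_integral p (of_int a / of_int b)"
proof -
  obtain n d where q: "quotient_of (of_int a / of_int b) = (n, d)"
    by force
  have "d > 0"
    using quotient_of_denom_pos[OF q] .
  have "(of_int a / of_int b :: rat) = of_int n / of_int d"
    using quotient_of_div[OF q] .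
  then have "(of_int (a * d) :: rat) = of_int (n * b)"
    using \<open>d > 0\<close> \<open>b \<noteq> 0\<close> by (simp add: field_simps)
  then have "a * d = n * b"
    by (simp only: of_int_eq_iff)
  then have "d dvd n * b"
    by (metis dvd_triv_right)
  \<comment> \<open>The reduced denominator divides every other one, so it inherits coprimality to
    \<open>p\<close>.\<close>
  then have "d dvd b"
    using quotient_of_coprime[OF q] by (simp add: coprime_commute coprime_dvd_mult_right_iff)
  then show ?thesis
    using coprime_divisors[OF _ dvd_refl assms(1)] q by (simp add: p_integral_def)
qed

text \<open>If \<open>a - b * c = p * k\<close>, the cofactor \<open>k / b\<close> is again integral
  at \<open>p\<close>, so clearing denominators is legitimate.\<close>

lemma rat_cong_of_int_divideI:
  assumes "coprime b (int p)" "b \<noteq> 0" "[a = b * c] (mod int p)"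
  shows "rat_cong p (of_int a / of_int b) (of_int c)"
proof -
  obtain k where k: "a - b * c = int p * k"
    using assms(3) by (auto simp: cong_iff_dvd_diff)
  have "(of_int a / of_int b :: rat) - of_int c = of_int (a - b * c) / of_int b"
    using assms(2) by (simp add: field_simps)
  also have "\<dots> = of_nat p * (of_int k / of_int b)"
    by (simp add: k)
  finally have "(of_int a / of_int b :: rat) - of_int c = of_nat p * (of_int k / of_int b)" .
  moreover have "p_integral p (of_int c)"
    using p_integral_of_int_divide[of 1 p c] by simp
  ultimately show ?thesis
    using p_integral_of_int_divide[OF assms(1,2)] unfolding rat_cong_def by blast
qed

section \<open>Congruences for central binomials and powers of 2\<close>

text \<open>Passing from \<open>j\<close> to \<open>j + 1\<close> multiplies the two sides by
  \<open>2 * (2 * j + 1) / (j + 1)\<close> and \<open>- 4 * (m - j) / (j + 1)\<close>, and these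
  factors agree modulo \<open>p\<close>.\<close>

lemma central_binomial_cong:
  fixes p m j :: nat
  assumes "prime p" "p = 2 * m + 1" "j \<le> m"
  shows "[int ((2 * j) choose j) = (- 4) ^ j * int (m choose j)] (mod int p)"
  using assms(3)
proof (induction j)
  case 0
  then show ?case by simp
next
  case (Suc j)
  let ?B = "\<lambda>j. int ((2 * j) choose j)" and ?M = "\<lambda>j. int (m choose j)"
  have "Suc j * (Suc (Suc (2 * j)) choose Suc j) = 2 * (Suc j * (Suc (2 * j) choose j))"
    using Suc_times_binomial[of j "Suc (2 * j)"] by (simp only: mult_ac) simp
  moreover have "Suc j * (Suc (2 * j) choose j) = Suc (2 * j) * ((2 * j) choose j)"
    using binomial_absorb_comp[of "Suc (2 * j)" j] by simp
  ultimately have "Suc j * ((2 * Suc j) choose Suc j) = 2 * (Suc (2 * j) * ((2 * j) choose j))"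
    by simp
  then have B: "int (Suc j) * ?B (Suc j) = 2 * (2 * int j + 1) * ?B j"
    by (simp only: flip: of_nat_mult) (simp add: algebra_simps)
  have "Suc j * (m choose Suc j) = (m - j) * (m choose j)"
    using binomial_absorption[of j m] binomial_absorb_comp[of m j] by simp
  then have "int (Suc j) * ?M (Suc j) = int (m - j) * ?M j"
    by (simp only: flip: of_nat_mult)
  then have M: "int (Suc j) * ?M (Suc j) = (int m - int j) * ?M j"
    using Suc.prems by simp
  \<comment> \<open>The difference is \<open>4 * m + 2\<close>, twice \<open>p\<close>.\<close>
  have "2 * (2 * int j + 1) - (- 4 * (int m - int j)) = int p * 2"
    using assms(2) by simp
  then have "[2 * (2 * int j + 1) = - 4 * (int m - int j)] (mod int p)"
    unfolding cong_iff_dvd_diff by (rule dvdI)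
  moreover have "[?B j = (- 4) ^ j * ?M j] (mod int p)"
    using Suc by simp
  ultimately have "[2 * (2 * int j + 1) * ?B j
      = - 4 * (int m - int j) * ((- 4) ^ j * ?M j)] (mod int p)"
    by (rule cong_mult)
  also have "- 4 * (int m - int j) * ((- 4) ^ j * ?M j) = (- 4) ^ Suc j * ((int m - int j) * ?M j)"
    by (simp add: algebra_simps)
  also have "\<dots> = int (Suc j) * ((- 4) ^ Suc j * ?M (Suc j))"
    unfolding M[symmetric] by (simp only: mult_ac)
  finally have "[int (Suc j) * ?B (Suc j) = int (Suc j) * ((- 4) ^ Suc j * ?M (Suc j))] (mod int p)"
    unfolding B .
  \<comment> \<open>Since \<open>j + 1 \<le> m < p\<close>, this factor can be cancelled.\<close>
  moreover have "coprime (int (Suc j)) (int p)"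
  proof -
    have "\<not> p dvd Suc j"
      using Suc.prems assms(2) by (auto dest: dvd_imp_le)
    then show ?thesis
      using assms(1) by (metis coprime_commute coprime_int_iff prime_imp_coprime)
  qed
  ultimately show ?case
    by (simp only: cong_mult_lcancel)
qed

text \<open>By Gauss' lemma the exponent counts the doubles \<open>2 * x\<close> with
  \<open>1 \<le> x \<le> m\<close> that exceed \<open>m = (p - 1) / 2\<close>.\<close>

lemma two_power_half_cong:
  fixes p m :: nat
  assumes "prime p" "p = 2 * m + 1"
  shows "[2 ^ m = (- 1) ^ (m - m div 2)] (mod int p)"
proof -
  have "m > 0"
    using assms by (cases m) auto
  interpret GAUSS p 2
    using assms \<open>m > 0\<close> by unfold_locales (auto simp: cong_def)
  have m: "(int p - 1) div 2 = int m"
    using assms(2) by simp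
  \<comment> \<open>The doubles are at most \<open>2 * m < p\<close>, so reduction modulo
    \<open>p\<close> leaves them unchanged.\<close>
  have "C = B"
    unfolding C_def B_def A_def m using assms(2) by (force simp: image_image intro!: image_cong)
  then have "E = (\<lambda>x. x * 2) ` {int (m div 2) <.. int m}"
    unfolding E_def B_def A_def m by (auto simp: zdiv_int image_iff)
  then have "card E = m - m div 2"
    by (simp add: card_image inj_on_def)
  then show ?thesis
    using pre_gauss_lemma by (simp add: m)
qed

section \<open>Roots of unity filter for binomial sums\<close>

text \<open>Real part of \<open>(1 + cis x) ^ m\<close>, using the half-angle factorization
  \<open>1 + cis x = 2 * cos (x / 2) * cis (x / 2)\<close>.\<close>

lemma sum_binomial_cos:
  fixes x :: real
  shows "(\<Sum>j\<le>m. real (m choose j) * cos (real j * x)) = (2 * cos (x / 2)) ^ m * cos (real m * x / 2)"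
proof -
  have "1 + cis x = of_real (2 * cos (x / 2)) * cis (x / 2)"
    using cos_double_cos[of "x / 2"] sin_double[of "x / 2"]
    by (auto simp: complex_eq_iff power2_eq_square)
  then have "(cis x + 1) ^ m = of_real ((2 * cos (x / 2)) ^ m) * cis (real m * (x / 2))"
    by (simp add: add.commute power_mult_distrib DeMoivre)
  moreover have "(cis x + 1) ^ m = (\<Sum>j\<le>m. of_real (real (m choose j)) * cis (real j * x))"
    by (simp add: binomial_ring DeMoivre)
  ultimately have "Re (\<Sum>j\<le>m. of_real (real (m choose j)) * cis (real j * x)) =
      Re (of_real ((2 * cos (x / 2)) ^ m) * cis (real m * (x / 2)))"
    by simp
  then show ?thesis
    by (simp only: Re_sum times_complex.sel Re_complex_of_real Im_complex_of_real cis.sel) simp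
qed

lemma cos_sixths_add: "cos (real (6 * t + s) * pi / 6) = (- 1) ^ t * cos (real s * pi / 6)"
proof -
  have "real (6 * t + s) * pi / 6 = real s * pi / 6 + real t * pi"
    by (simp add: field_simps)
  then show ?thesis
    by (simp only: cos_add) simp
qed

lemma cos_sixths:
  "cos (real 0 * pi / 6) = 1" "cos (real 1 * pi / 6) = sqrt 3 / 2" "cos (real 2 * pi / 6) = 1 / 2"
  "cos (real 3 * pi / 6) = 0" "cos (real 4 * pi / 6) = - (1 / 2)"
  "cos (real 5 * pi / 6) = - (sqrt 3 / 2)"
  using cos_30 cos_60 cos_pi_minus[of "pi / 6"] cos_pi_minus[of "pi / 3"]
  by (simp_all add: field_simps)

text \<open>This is the sum of \<open>z ^ j\<close> over the sixth roots of unity: 1 and -1 give the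
  first two terms, the two conjugate pairs the doubled cosines.\<close>

lemma sixth_roots_filter:
  "1 + cos (real j * pi) + 2 * cos (real j * (pi / 3)) + 2 * cos (real j * (2 * pi / 3)) =
    (if 6 dvd j then 6 else 0)"
proof -
  define t s where "t = j div 6" and "s = j mod 6"
  have j: "j = 6 * t + s" and "s < 6"
    by (simp_all add: t_def s_def)
  have 1: "real j * (pi / 3) = real (6 * (2 * t) + 2 * s) * pi / 6"
    by (simp add: j field_simps)
  have 2: "real j * (2 * pi / 3) = real (6 * (4 * t) + 4 * s) * pi / 6"
    by (simp add: j field_simps)
  have 3: "cos (real j * pi) = (- 1) ^ s"
    unfolding cos_npi by (simp add: j power_add power_mult)
  have "s \<in> {0, 1, 2, 3, 4, 5}"
    using \<open>s < 6\<close> by auto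
  moreover have "6 dvd j \<longleftrightarrow> s = 0"
    by (simp add: s_def dvd_eq_mod_eq_0)
  \<comment> \<open>The multiples \<open>2 * s\<close> and \<open>4 * s\<close> reach 20; the
    instances of \<open>cos_sixths_add\<close> bring those from 6 on back below 6.\<close>
  ultimately show ?thesis
    unfolding 1 2 3 cos_sixths_add
    using cos_sixths cos_sixths_add[of 1 0] cos_sixths_add[of 1 2] cos_sixths_add[of 1 4]
      cos_sixths_add[of 2 0] cos_sixths_add[of 2 4] cos_sixths_add[of 3 2]
    by (auto simp: mult.commute)
qed

lemma sum_binomial_multiples_of_6:
  assumes "m > 0"
  shows "6 * (\<Sum>k\<le>m div 6. real (m choose (6 * k))) =
    2 ^ m + 2 * cos (real (2 * m) * pi / 6) + 2 * sqrt 3 ^ m * cos (real m * pi / 6)"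
proof -
  have "(\<Sum>k\<le>m div 6. real (m choose (6 * k))) = (\<Sum>j | j \<le> m \<and> 6 dvd j. real (m choose j))"
    by (rule sum.reindex_bij_witness[of _ "\<lambda>j. j div 6" "\<lambda>k. 6 * k"]) auto
  also have "6 * \<dots> = (\<Sum>j\<le>m. real (m choose j) * (if 6 dvd j then 6 else 0))"
    by (simp add: sum_distrib_left if_distrib mult.commute
        flip: sum.inter_filter cong: if_cong)
  also have "\<dots> = (\<Sum>j\<le>m. real (m choose j) * cos (real j * 0))
      + (\<Sum>j\<le>m. real (m choose j) * cos (real j * pi))
      + 2 * (\<Sum>j\<le>m. real (m choose j) * cos (real j * (pi / 3)))
      + 2 * (\<Sum>j\<le>m. real (m choose j) * cos (real j * (2 * pi / 3)))"
    unfolding sixth_roots_filter[symmetric]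
    by (simp add: distrib_left sum.distrib sum_distrib_left mult.left_commute)
  \<comment> \<open>For the angles 0, \<open>pi\<close>, \<open>pi / 3\<close>,
    \<open>2 * pi / 3\<close> the base \<open>2 * cos (x / 2)\<close> is 2, 0,
    \<open>sqrt 3\<close>, 1; the second sum vanishes because \<open>m > 0\<close>.\<close>
  also have "\<dots> = 2 ^ m + 2 * cos (real (2 * m) * pi / 6) + 2 * sqrt 3 ^ m * cos (real m * pi / 6)"
    unfolding sum_binomial_cos using assms by (simp add: cos_30 cos_60 mult_ac)
  finally show ?thesis .
qed

text \<open>The residues 1 and 4 of \<open>m\<close> modulo 6 are left out because they make
  \<open>2 * m + 1\<close> divisible by 3.\<close>

lemma sum_binomial_multiples_of_6_cases:
  fixes m t :: nat
  assumes "m > 0"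
  defines "T \<equiv> 6 * (\<Sum>k\<le>m div 6. int (m choose (6 * k)))"
  shows "m = 6 * t \<Longrightarrow> T = 2 ^ m + (2 + 2 * (- 1) ^ t * 3 ^ (3 * t))"
    and "m = 6 * t + 2 \<Longrightarrow> T = 2 ^ m + (- 1 + (- 1) ^ t * 3 ^ (3 * t + 1))"
    and "m = 6 * t + 3 \<Longrightarrow> T = 2 ^ m + - 2"
    and "m = 6 * t + 5 \<Longrightarrow> T = 2 ^ m + (1 - (- 1) ^ t * 3 ^ (3 * t + 3))"
proof -
  \<comment> \<open>Each block of six contributes \<open>sqrt 3 ^ 6 = 27\<close> and a sign; the
    doubled angle has \<open>2 * t\<close> blocks, hence no sign.\<close>
  have T: "real_of_int T = 2 ^ m + 2 * cos (real (2 * s) * pi / 6)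
      + 2 * (27 ^ t * sqrt 3 ^ s) * ((- 1) ^ t * cos (real s * pi / 6))" if "m = 6 * t + s" for s
  proof -
    have "real (2 * m) = real (6 * (2 * t) + 2 * s)"
      by (simp add: that)
    then have "cos (real (2 * m) * pi / 6) = cos (real (2 * s) * pi / 6)"
      by (simp only: cos_sixths_add) simp
    moreover have "sqrt 3 ^ m = 27 ^ t * sqrt 3 ^ s"
    proof -
      have "sqrt 3 ^ 6 = ((sqrt 3)\<^sup>2) ^ 3"
        by (simp only: flip: power_mult) simp
      then show ?thesis
        by (simp add: that power_add power_mult)
    qed
    moreover have "cos (real m * pi / 6) = (- 1) ^ t * cos (real s * pi / 6)"
      unfolding that by (rule cos_sixths_add)
    ultimately show ?thesis
      using sum_binomial_multiples_of_6[OF assms(1)] by (simp add: T_def)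
  qed
  have sqrt_3_powers: "sqrt 3 * (sqrt 3 * x) = 3 * x" "sqrt 3 ^ 5 = 9 * sqrt 3" for x
    by (simp_all add: eval_nat_numeral flip: mult.assoc)
  have eqI: "T = c" if "real_of_int T = real_of_int c" for c
    using that by (simp only: of_int_eq_iff)
  show "T = 2 ^ m + (2 + 2 * (- 1) ^ t * 3 ^ (3 * t))" if "m = 6 * t"
    by (rule eqI, subst T[of 0]) (simp_all add: that power_mult)
  show "T = 2 ^ m + (- 1 + (- 1) ^ t * 3 ^ (3 * t + 1))" if "m = 6 * t + 2"
    by (rule eqI, subst T[of 2])
      (use cos_sixths cos_sixths_add[of 0 4] in \<open>simp_all add: that power_mult\<close>)
  show "T = 2 ^ m + - 2" if "m = 6 * t + 3"
    by (rule eqI, subst T[of 3])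
      (use cos_sixths cos_sixths_add[of 1 0] in \<open>simp_all add: that\<close>)
  show "T = 2 ^ m + (1 - (- 1) ^ t * 3 ^ (3 * t + 3))" if "m = 6 * t + 5"
    by (rule eqI, subst T[of 5])
      (use cos_sixths cos_sixths_add[of 1 4] in
        \<open>simp_all add: that power_mult power_add sqrt_3_powers\<close>)
qed

section \<open>The eight residue classes of \<open>p\<close> modulo 24\<close>

theorem theorem4p3:
  fixes p :: nat
  assumes "prime p" and "p > 3"
  shows "let S = 6 * (\<Sum>k = 0..(p - 1) div 12. of_nat ((12 * k) choose (6 * k)) / 4 ^ (6 * k)) :: rat in
    (p mod 24 = 1 \<longrightarrow> rat_cong p S (2 * 3 ^ ((p - 1) div 4) + 3)) \<and>
    (p mod 24 = 5 \<longrightarrow> rat_cong p S (3 ^ ((p - 1) div 4) - 2)) \<and>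
    (p mod 24 = 7 \<longrightarrow> rat_cong p S (- 1)) \<and>
    (p mod 24 = 11 \<longrightarrow> rat_cong p S (- (3 ^ ((p + 1) div 4)))) \<and>
    (p mod 24 = 13 \<longrightarrow> rat_cong p S (1 - 2 * 3 ^ ((p - 1) div 4))) \<and>
    (p mod 24 = 17 \<longrightarrow> rat_cong p S (- (3 ^ ((p - 1) div 4)))) \<and>
    (p mod 24 = 19 \<longrightarrow> rat_cong p S (- 3)) \<and>
    (p mod 24 = 23 \<longrightarrow> rat_cong p S (2 + 3 ^ ((p + 1) div 4)))"
proof -
  define S :: rat where
    "S = 6 * (\<Sum>k = 0..(p - 1) div 12. of_nat ((12 * k) choose (6 * k)) / 4 ^ (6 * k))"
  have "odd p"
    using assms prime_odd_nat by auto
  then obtain m where p: "p = 2 * m + 1"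
    by (elim oddE)
  define M where "M = m div 6"
  \<comment> \<open>A common denominator of all summands, prime to the odd \<open>p\<close>.\<close>
  define b :: int where "b = 4 ^ (6 * M)"
  define a where "a = 6 * (\<Sum>k\<le>M. int ((12 * k) choose (6 * k)) * 4 ^ (6 * (M - k)))"
  define T where "T = 6 * (\<Sum>k\<le>M. int (m choose (6 * k)))"
  have "m > 0"
    using assms p by simp
  have M: "(p - 1) div 12 = M"
    unfolding p M_def by simp
  have S: "S = of_int a / of_int b"
  proof -
    have "of_nat ((12 * k) choose (6 * k)) / 4 ^ (6 * k) =
        (of_int (int ((12 * k) choose (6 * k)) * 4 ^ (6 * (M - k))) / of_int b :: rat)"
      if "k \<le> M" for k
    proof -
      have "b = 4 ^ (6 * k) * 4 ^ (6 * (M - k))"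
        using that by (simp add: b_def flip: power_add distrib_left)
      then show ?thesis
        by simp
    qed
    then show ?thesis
      unfolding S_def M a_def atLeast0AtMost by (simp flip: sum_divide_distrib)
  qed
  have "coprime b (int p)"
  proof -
    have "coprime (2 ^ 2) (int p)"
      using \<open>odd p\<close> by (simp only: coprime_power_left_iff) simp
    then show ?thesis
      by (simp add: b_def)
  qed
  have "[a = 6 * (\<Sum>k\<le>M. b * int (m choose (6 * k)))] (mod int p)"
    unfolding a_def
  proof (rule cong_mult[OF cong_refl cong_sum])
    fix k assume "k \<in> {..M}"
    then have "k \<le> M" by simp
    then have "[int ((2 * (6 * k)) choose (6 * k)) = (- 4) ^ (6 * k) * int (m choose (6 * k))] (mod int p)"
      using assms(1) p by (intro central_binomial_cong) (auto simp: M_def)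
    then have "[int ((12 * k) choose (6 * k)) * 4 ^ (6 * (M - k)) =
        4 ^ (6 * k) * int (m choose (6 * k)) * 4 ^ (6 * (M - k))] (mod int p)"
      by (intro cong_mult cong_refl) simp
    moreover have "b = 4 ^ (6 * k) * 4 ^ (6 * (M - k))"
      using \<open>k \<le> M\<close> by (simp add: b_def flip: power_add distrib_left)
    ultimately show "[int ((12 * k) choose (6 * k)) * 4 ^ (6 * (M - k)) =
        b * int (m choose (6 * k))] (mod int p)"
      by (simp add: mult_ac)
  qed
  then have a: "[a = b * T] (mod int p)"
    by (simp add: T_def sum_distrib_left mult_ac)
  \<comment> \<open>Only \<open>2 ^ m\<close> is reduced, to its sign; the remainder
    \<open>d\<close> stays exact.\<close>
  have cong: "rat_cong p S (of_int c)" if "T = 2 ^ m + d" "(- 1) ^ (m - m div 2) + d = c" for c d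
  proof -
    have "[T = c] (mod int p)"
      using two_power_half_cong[OF assms(1) p] unfolding that(1) that(2)[symmetric]
      by (intro cong_add cong_refl)
    then have "[b * T = b * c] (mod int p)"
      by (intro cong_mult cong_refl)
    then show ?thesis
      unfolding S using a \<open>coprime b (int p)\<close>
      by (intro rat_cong_of_int_divideI) (auto simp: b_def intro: cong_trans)
  qed
  \<comment> \<open>With \<open>r = p mod 24\<close>, \<open>m = 12 * q + (r - 1) / 2\<close>, so
    the number \<open>t\<close> of blocks of six is \<open>2 * q\<close> or
    \<open>2 * q + 1\<close>; its parity fixes the sign of the power of 3.\<close>
  define q where "q = p div 24"
  have q: "p = 24 * q + p mod 24"
    by (simp add: q_def)
  note T_cases = sum_binomial_multiples_of_6_cases[OF \<open>m > 0\<close>, folded M_def, folded T_def]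
  show ?thesis
    unfolding S_def[symmetric] Let_def
  proof (intro conjI impI)
    assume "p mod 24 = 1"
    then have m: "m = 6 * (2 * q)"
      using p q by simp
    \<comment> \<open>In each case the parity in \<open>e\<close> decides the residue of
      \<open>2 ^ m\<close>, and \<open>f\<close> matches the exponent of 3 with that in
      \<open>T_cases\<close>.\<close>
    then have e: "m - m div 2 = 6 * q" and f: "(p - 1) div 4 = 6 * q"
      using p by presburger+
    from cong[OF T_cases(1)[OF m] refl] show "rat_cong p S (2 * 3 ^ ((p - 1) div 4) + 3)"
      unfolding f by (simp add: e power_add power_mult add.commute)
  next
    assume "p mod 24 = 5"
    then have m: "m = 6 * (2 * q) + 2"
      using p q by simp
    then have e: "m - m div 2 = 6 * q + 1" and f: "(p - 1) div 4 = 6 * q + 1"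
      using p by presburger+
    from cong[OF T_cases(2)[OF m] refl] show "rat_cong p S (3 ^ ((p - 1) div 4) - 2)"
      unfolding f by (simp add: e power_add power_mult)
  next
    assume "p mod 24 = 7"
    then have m: "m = 6 * (2 * q) + 3"
      using p q by simp
    then have e: "m - m div 2 = 6 * q + 2"
      using p by presburger
    \<comment> \<open>The exponent \<open>6 * q + 2\<close> is even, so the residue is
      \<open>1 - 2\<close>.\<close>
    from cong[OF T_cases(3)[OF m] refl] show "rat_cong p S (- 1)"
      by (simp add: e power_add power_mult)
  next
    assume "p mod 24 = 11"
    then have m: "m = 6 * (2 * q) + 5"
      using p q by simp
    then have e: "m - m div 2 = 6 * q + 3" and f: "(p + 1) div 4 = 6 * q + 3"
      using p by presburger+
    \<comment> \<open>Here \<open>2 ^ m\<close> has residue -1, which cancels the constant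
      1.\<close>
    from cong[OF T_cases(4)[OF m] refl] show "rat_cong p S (- (3 ^ ((p + 1) div 4)))"
      unfolding f by (simp add: e power_add power_mult)
  next
    assume "p mod 24 = 13"
    then have m: "m = 6 * (2 * q + 1)"
      using p q by simp
    then have e: "m - m div 2 = 6 * q + 3" and f: "(p - 1) div 4 = 6 * q + 3"
      using p by presburger+
    from cong[OF T_cases(1)[OF m] refl] show "rat_cong p S (1 - 2 * 3 ^ ((p - 1) div 4))"
      unfolding f by (simp add: e power_add power_mult)
  next
    assume "p mod 24 = 17"
    then have m: "m = 6 * (2 * q + 1) + 2"
      using p q by simp
    then have e: "m - m div 2 = 6 * q + 4" and f: "(p - 1) div 4 = 6 * q + 4"
      using p by presburger+
    \<comment> \<open>Here \<open>2 ^ m\<close> has residue 1, which cancels the constant -1; odd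
      \<open>t\<close> makes the power of 3 negative.\<close>
    from cong[OF T_cases(2)[OF m] refl] show "rat_cong p S (- (3 ^ ((p - 1) div 4)))"
      unfolding f by (simp add: e power_add power_mult mult.commute[of _ 81])
  next
    assume "p mod 24 = 19"
    then have m: "m = 6 * (2 * q + 1) + 3"
      using p q by simp
    then have e: "m - m div 2 = 6 * q + 5"
      using p by presburger
    from cong[OF T_cases(3)[OF m] refl] show "rat_cong p S (- 3)"
      by (simp add: e power_add power_mult)
  next
    assume "p mod 24 = 23"
    then have m: "m = 6 * (2 * q + 1) + 5"
      using p q by simp
    then have e: "m - m div 2 = 6 * q + 6" and f: "(p + 1) div 4 = 6 * q + 6"
      using p by presburger+
    from cong[OF T_cases(4)[OF m] refl] show "rat_cong p S (2 + 3 ^ ((p + 1) div 4))"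
      unfolding f by (simp add: e power_add power_mult mult.commute[of _ 729])
  qed
qed

end
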